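(* Let $f(x)=\sum_{i=1}^m f_i(x_{\Delta_i})$ be a real polynomial in $x=(x_1,\dots,x_n)$, where $\Delta_i\subset\{1,\dots,n\}$, each $f_i\in\mathbb{R}[x_{\Delta_i}]$ has even degree $2d_i$, and $\deg f=2d=\max_i 2d_i$. Then the optimal values $f^*_\Sigma$ (sparse moment relaxation), $f^*_\Delta$ (sparse SOS relaxation), $f^*_{sos}$ (standard SOS relaxation) and $f^*$ (global minimum value of $f$), as defined in the context, satisfy $$f^*_\Sigma=f^*_\Delta\le f^*_{sos}\le f^*.$$
   Context: Notation: $[n]=\{1,\dots,n\}$; for $\Delta_i\subset[n]$, $x_{\Delta_i}=(x_j)_{j\in\Delta_i}$. For $\alpha\in\mathbb{N}^n$ (with $0\in\mathbb{N}$), $x^\alpha=x_1^{\alpha_1}\cdots x_n^{\alpha_n}$, $|\alpha|=\sum_j\alpha_j$, $\mathrm{supp}(\alpha)=\{j:\alpha_j\ne0\}$. Write $f=\sum_\alpha f_\alpha x^\alpha$. A polynomial is SOS if it is a finite sum of squares of real polynomials. $\mathbf{m}_d(x_{\Delta_i})$ is the column vector of all monomials in $x_{\Delta_i}$ of degree at most $d$. Optimal values are suprema/infima in $[-\infty,+\infty]$. Values: - $f^*=\inf_{x\in\mathbb{R}^n}f(x)$. - $f^*_{sos}=\sup\{\gamma\in\mathbb{R}: f(x)-\gamma \text{ is SOS in } \mathbb{R}[x]\}$. - $f^*_\Delta=\sup\{\gamma\in\mathbb{R}: f(x)-\gamma=\sum_{i=1}^m \mathbf{m}_d(x_{\Delta_i})^T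 W_i\,\mathbf{m}_d(x_{\Delta_i})$ identically in $x$ for some real symmetric positive semidefinite matrices $W_1,\dots,W_m\}$. - Let $\mathcal{F}_i=\{\alpha\in\mathbb{N}^n:\mathrm{supp}(\alpha)\subset\Delta_i,\ |\alpha|\le 2d\}$ and $\mathcal{F}=\bigcup_{i=1}^m\mathcal{F}_i$. For $y=(y_\alpha)_{\alpha\in\mathcal{F}}$, $\mathcal{M}_d^{\Delta_i}(y)$ is the matrix with rows and columns indexed by $\{\alpha\in\mathbb{N}^n:\mathrm{supp}(\alpha)\subset\Delta_i,|\alpha|\le d\}$ and entries $\mathcal{M}_d^{\Delta_i}(y)(\alpha,\beta)=y_{\alpha+\beta}$. Then $f^*_\Sigma=\inf\{\sum_{\alpha\in\mathcal{F}}f_\alpha y_\alpha:\ y\in\mathbb{R}^{\mathcal{F}},\ \mathcal{M}_d^{\Delta_i}(y)\succeq0\ (i=1,\dots,m),\ y_0=1\}$. *)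

theory Defs
  imports
    "HOL-Analysis.Analysis"
    "HOL-Library.Poly_Mapping"
    "HOL-Library.FuncSet"
    "HOL-Library.Extended_Real"
begin

text \<open>
  The variables are indexed by a finite type \<open>'n\<close> (so \<open>n = CARD('n)\<close>). Exponent vectors are
  elements of \<open>'n \<Rightarrow>\<^sub>0 nat\<close>, and real polynomials in these variables are elements
  of \<open>('n \<Rightarrow>\<^sub>0 nat) \<Rightarrow>\<^sub>0 real\<close>, whose ring structure is the convolution product
  of \<open>Poly_Mapping\<close>.
\<close>

type_synonym 'n expo = "'n \<Rightarrow>\<^sub>0 nat"
type_synonym 'n rpoly = "'n expo \<Rightarrow>\<^sub>0 real"

abbreviation coeff :: "'n rpoly \<Rightarrow> 'n expo \<Rightarrow> real"
  where "coeff \<equiv> Poly_Mapping.lookup"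

abbreviation supp :: "'n expo \<Rightarrow> 'n set"
  where "supp \<equiv> Poly_Mapping.keys"

definition expo_deg :: "'n::finite expo \<Rightarrow> nat"
  where "expo_deg \<alpha> = (\<Sum>j\<in>UNIV. Poly_Mapping.lookup \<alpha> j)"

definition const_poly :: "real \<Rightarrow> 'n rpoly"
  where "const_poly c = Poly_Mapping.single 0 c"

definition monom_poly :: "'n expo \<Rightarrow> 'n rpoly"
  where "monom_poly \<alpha> = Poly_Mapping.single \<alpha> 1"

definition poly_eval :: "'n::finite rpoly \<Rightarrow> real ^ 'n \<Rightarrow> real"
  where "poly_eval p x =
    (\<Sum>\<alpha>\<in>Poly_Mapping.keys p. coeff p \<alpha> * (\<Prod>j\<in>UNIV. (x $ j) ^ Poly_Mapping.lookup \<alpha> j))"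

text \<open>The zero polynomial gets total degree \<open>0\<close>.\<close>

definition total_degree :: "'n::finite rpoly \<Rightarrow> nat"
  where "total_degree p = Max (insert 0 (expo_deg ` Poly_Mapping.keys p))"

definition polys_in :: "'n set \<Rightarrow> 'n rpoly set"
  where "polys_in D = {p. \<forall>\<alpha>\<in>Poly_Mapping.keys p. supp \<alpha> \<subseteq> D}"

definition SOS :: "'n rpoly \<Rightarrow> bool"
  where "SOS p \<longleftrightarrow> (\<exists>(N::nat) q. p = (\<Sum>k<N. (q k)\<^sup>2))"

definition expos :: "'n::finite set \<Rightarrow> nat \<Rightarrow> 'n expo set"
  where "expos D k = {\<alpha>. supp \<alpha> \<subseteq> D \<and> expo_deg \<alpha> \<le> k}"

text \<open>The sums over \<open>expos D k\<close> below are honest finite sums.\<close>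

lemma finite_expos: "finite (expos D k)"
proof (rule finite_imageD)
  have "Poly_Mapping.lookup ` expos D k \<subseteq> PiE UNIV (\<lambda>_. {..k})"
  proof (clarsimp simp: expos_def PiE_def Pi_def)
    fix \<alpha> :: "'a expo" and j assume "expo_deg \<alpha> \<le> k"
    moreover have "Poly_Mapping.lookup \<alpha> j \<le> expo_deg \<alpha>"
      unfolding expo_deg_def by (rule member_le_sum) auto
    ultimately show "Poly_Mapping.lookup \<alpha> j \<le> k" by linarith
  qed
  then show "finite (Poly_Mapping.lookup ` expos D k)"
    by (rule finite_subset) (intro finite_PiE, auto)
  show "inj_on Poly_Mapping.lookup (expos D k)"
    by (simp add: inj_on_def poly_mapping_eqI)
qed

text \<open>
  Matrices whose rows and columns are indexed by a finite set \<open>B\<close> are functions of two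
  arguments, of which only the values on \<open>B \<times> B\<close> matter.
\<close>

definition psd_on :: "'b set \<Rightarrow> ('b \<Rightarrow> 'b \<Rightarrow> real) \<Rightarrow> bool"
  where "psd_on B A \<longleftrightarrow>
    (\<forall>a\<in>B. \<forall>b\<in>B. A a b = A b a) \<and>
    (\<forall>v. 0 \<le> (\<Sum>a\<in>B. \<Sum>b\<in>B. v a * A a b * v b))"

text \<open>\<open>gram_poly D d W\<close> is \<open>m\<^sub>d(x\<^sub>D)\<^sup>T W m\<^sub>d(x\<^sub>D)\<close> as a polynomial.\<close>

definition gram_poly :: "'n::finite set \<Rightarrow> nat \<Rightarrow> ('n expo \<Rightarrow> 'n expo \<Rightarrow> real) \<Rightarrow> 'n rpoly"
  where "gram_poly D d W =
    (\<Sum>\<alpha>\<in>expos D d. \<Sum>\<beta>\<in>expos D d. monom_poly \<alpha> * const_poly (W \<alpha> \<beta>) * monom_poly \<beta>)"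

definition moment_matrix :: "('n expo \<Rightarrow> real) \<Rightarrow> 'n expo \<Rightarrow> 'n expo \<Rightarrow> real"
  where "moment_matrix y \<alpha> \<beta> = y (\<alpha> + \<beta>)"

definition f_star :: "'n::finite rpoly \<Rightarrow> ereal"
  where "f_star f = (INF x. ereal (poly_eval f x))"

definition f_sos :: "'n rpoly \<Rightarrow> ereal"
  where "f_sos f = (SUP \<gamma> \<in> {\<gamma>. SOS (f - const_poly \<gamma>)}. ereal \<gamma>)"

definition f_Delta :: "nat \<Rightarrow> (nat \<Rightarrow> 'n::finite set) \<Rightarrow> nat \<Rightarrow> 'n rpoly \<Rightarrow> ereal"
  where "f_Delta m \<Delta> d f =
    (SUP \<gamma> \<in> {\<gamma>. \<exists>W. (\<forall>i\<in>{1..m}. psd_on (expos (\<Delta> i) d) (W i)) \<and>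
                   f - const_poly \<gamma> = (\<Sum>i=1..m. gram_poly (\<Delta> i) d (W i))}. ereal \<gamma>)"

definition sparse_expos :: "nat \<Rightarrow> (nat \<Rightarrow> 'n::finite set) \<Rightarrow> nat \<Rightarrow> 'n expo set"
  where "sparse_expos m \<Delta> d = (\<Union>i\<in>{1..m}. expos (\<Delta> i) (2 * d))"

definition f_Sigma :: "nat \<Rightarrow> (nat \<Rightarrow> 'n::finite set) \<Rightarrow> nat \<Rightarrow> 'n rpoly \<Rightarrow> ereal"
  where "f_Sigma m \<Delta> d f =
    (INF y \<in> {y \<in> sparse_expos m \<Delta> d \<rightarrow>\<^sub>E UNIV.
                (\<forall>i\<in>{1..m}. psd_on (expos (\<Delta> i) d) (moment_matrix y)) \<and> y 0 = 1}.
       ereal (\<Sum>\<alpha>\<in>sparse_expos m \<Delta> d. coeff f \<alpha> * y \<alpha>))"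

end

theory Submission
  imports Defs
begin

text \<open>
  A Cholesky decomposition writes positive semidefinite matrices as sums of rank-one matrices, so
  Gram polynomials are SOS and pair nonnegatively with positive semidefinite moment matrices;
  this gives every inequality except \<open>f_Sigma \<le> f_Delta\<close>. For that one, suppose that
  \<open>f - \<gamma>\<close> has no sparse Gram representation. The cone of representable polynomials is closed
  because the functional with moments \<open>t ^ (\<Sum>j. \<alpha>\<^sub>j\<^sup>2)\<close>, for large \<open>t\<close>, bounds the traces of the
  Gram matrices. So there is a point of the cone nearest to \<open>f - \<gamma>\<close>, and the residual there is a
  functional that is nonnegative on the cone and negative at \<open>f - \<gamma>\<close>. Adding a small multiple of
  evaluation at the origin and normalising gives a feasible moment vector of value at most \<open>\<gamma>\<close>.
\<close>

subsection \<open>Positive semidefinite matrices\<close>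

lemma psd_onD_sym: "psd_on B A \<Longrightarrow> a \<in> B \<Longrightarrow> b \<in> B \<Longrightarrow> A a b = A b a"
  by (simp add: psd_on_def)

lemma psd_onD_nonneg: "psd_on B A \<Longrightarrow> 0 \<le> (\<Sum>a\<in>B. \<Sum>b\<in>B. v a * A a b * v b)"
  by (simp add: psd_on_def)

text \<open>Isolates one coordinate: the form becomes a quadratic polynomial in \<open>v x\<close>.
  Symmetry between row and column \<open>x\<close> merges the two cross sums into the factor
  2.\<close>

lemma quadratic_form_insert:
  fixes A :: "'b \<Rightarrow> 'b \<Rightarrow> real"
  assumes "finite B" "x \<notin> B" "\<And>b. b \<in> B \<Longrightarrow> A b x = A x b"
  shows "(\<Sum>a\<in>insert x B. \<Sum>b\<in>insert x B. v a * A a b * v b) =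
    (v x)\<^sup>2 * A x x + 2 * v x * (\<Sum>b\<in>B. A x b * v b) + (\<Sum>a\<in>B. \<Sum>b\<in>B. v a * A a b * v b)"
  using assms
  by (simp add: sum.distrib power2_eq_square sum_distrib_left mult_ac)

lemma affine_nonneg_imp_slope_zero:
  fixes p q :: real
  assumes "\<And>s. 0 \<le> s * p + q"
  shows "p = 0"
proof (rule ccontr)
  assume "p \<noteq> 0"
  \<comment> \<open>The instance of \<open>assms\<close> taken here has value -1.\<close>
  then show False
    using assms[of "- (q + 1) / p"] by simp
qed

lemma psd_on_diag_nonneg:
  fixes A :: "'b \<Rightarrow> 'b \<Rightarrow> real"
  assumes "finite B" "psd_on B A" "x \<in> B"
  shows "0 \<le> A x x"
proof -
  have "0 \<le> (\<Sum>a\<in>B. \<Sum>b\<in>B. of_bool (a = x) * A a b * of_bool (b = x))"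
    using assms(2) by (rule psd_onD_nonneg)
  also have "\<dots> = (\<Sum>a\<in>B. if a = x then \<Sum>b\<in>B. if b = x then A x x else 0 else 0)"
    by (intro sum.cong) (auto intro!: sum.cong)
  also have "\<dots> = A x x"
    using assms by simp
  finally show ?thesis .
qed

text \<open>Along \<open>s * e_x + e_b\<close> the vanishing diagonal entry leaves an affine
  function of \<open>s\<close> with slope \<open>2 * A x b\<close>, and a nonnegative affine
  function is constant.\<close>

lemma psd_on_diag_zero:
  fixes A :: "'b \<Rightarrow> 'b \<Rightarrow> real"
  assumes "finite B" "psd_on B A" "x \<in> B" "A x x = 0" "b \<in> B"
  shows "A x b = 0"
proof (cases "b = x")
  case False
  define C where "C = B - {x}"
  have C: "B = insert x C" "x \<notin> C" "finite C" "b \<in> C"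
    using assms False by (auto simp: C_def)
  have "0 \<le> s * (2 * A x b) + A b b" for s
  proof -
    define v where "v = (\<lambda>a. if a = x then s else of_bool (a = b))"
    have "0 \<le> (\<Sum>a\<in>B. \<Sum>b\<in>B. v a * A a b * v b)"
      using assms by (simp add: psd_on_def)
    also have "\<dots> = (v x)\<^sup>2 * A x x + 2 * v x * (\<Sum>b\<in>C. A x b * v b) +
        (\<Sum>a\<in>C. \<Sum>b\<in>C. v a * A a b * v b)"
      using C psd_onD_sym[OF assms(2)] unfolding C(1) by (intro quadratic_form_insert) auto
    also have "(\<Sum>c\<in>C. A x c * v c) = (\<Sum>c\<in>C. if c = b then A x b else 0)"
      using C by (intro sum.cong) (auto simp: v_def)
    also have "\<dots> = A x b" using C by simp
    also have "(\<Sum>a\<in>C. \<Sum>c\<in>C. v a * A a c * v c) =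
        (\<Sum>a\<in>C. if a = b then (\<Sum>c\<in>C. if c = b then A b b else 0) else 0)"
    proof (intro sum.cong refl)
      fix a assume "a \<in> C"
      then have "v a = of_bool (a = b)" using C by (auto simp: v_def)
      moreover have "v c = of_bool (c = b)" if "c \<in> C" for c
        using C that by (auto simp: v_def)
      ultimately show "(\<Sum>c\<in>C. v a * A a c * v c) =
          (if a = b then (\<Sum>c\<in>C. if c = b then A b b else 0) else 0)"
        by (auto intro!: sum.cong)
    qed
    also have "\<dots> = A b b" using C by simp
    finally show ?thesis using assms(4) by (simp add: v_def mult_ac)
  qed
  from affine_nonneg_imp_slope_zero[OF this] show ?thesis by simp
qed (use assms in simp)

text \<open>Cholesky decomposition: split off the row of \<open>x\<close> and recurse on the Schur complement.
  If \<open>A x x = 0\<close> the row vanishes and \<open>x / 0 = 0\<close> makes the formulas remain correct.\<close>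

lemma psd_on_rank_one_decomposition:
  fixes A :: "'b \<Rightarrow> 'b \<Rightarrow> real"
  assumes "finite B" "psd_on B A"
  shows "\<exists>(N::nat) q. \<forall>a\<in>B. \<forall>b\<in>B. A a b = (\<Sum>k<N. q k a * q k b)"
  using assms
proof (induction B arbitrary: A rule: finite_induct)
  case empty
  then show ?case by simp
next
  case (insert x B)
  let ?S = "\<lambda>a b. A a b - A x a * A x b / A x x"
  have sym: "A a b = A b a" if "a \<in> insert x B" "b \<in> insert x B" for a b
    using psd_onD_sym[OF insert.prems] that by blast
  have pos: "0 \<le> A x x"
    using psd_on_diag_nonneg[OF _ insert.prems] insert.hyps by blast
  have row0: "A x b = 0" if "A x x = 0" "b \<in> insert x B" for b
    using psd_on_diag_zero[OF _ insert.prems] insert.hyps that by blast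
  have "psd_on B ?S"
    unfolding psd_on_def
  proof (intro conjI ballI allI)
    fix a b assume "a \<in> B" "b \<in> B"
    then show "?S a b = ?S b a" using sym[of a b] by simp
  next
    fix v :: "'b \<Rightarrow> real"
    define t where "t = (\<Sum>b\<in>B. A x b * v b)"
    \<comment> \<open>For \<open>A x x > 0\<close> this value minimises the form in the coordinate
      \<open>x\<close>; what remains is the form of the Schur complement at
      \<open>v\<close>.\<close>
    define w where "w = v(x := - t / A x x)"
    have w: "w b = v b" if "b \<in> B" for b using that insert.hyps by (auto simp: w_def)
    have "0 \<le> (\<Sum>a\<in>insert x B. \<Sum>b\<in>insert x B. w a * A a b * w b)"
      using insert.prems by (rule psd_onD_nonneg)
    also have "\<dots> = (w x)\<^sup>2 * A x x + 2 * w x * (\<Sum>b\<in>B. A x b * w b) +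
        (\<Sum>a\<in>B. \<Sum>b\<in>B. w a * A a b * w b)"
      using insert.hyps by (intro quadratic_form_insert sym) auto
    also have "(\<Sum>b\<in>B. A x b * w b) = t"
      by (simp add: w t_def)
    also have "(\<Sum>a\<in>B. \<Sum>b\<in>B. w a * A a b * w b) = (\<Sum>a\<in>B. \<Sum>b\<in>B. v a * A a b * v b)"
      by (simp add: w)
    also have "(w x)\<^sup>2 * A x x + 2 * w x * t + (\<Sum>a\<in>B. \<Sum>b\<in>B. v a * A a b * v b) =
        (\<Sum>a\<in>B. \<Sum>b\<in>B. v a * A a b * v b) - t * t / A x x"
      by (cases "A x x = 0") (simp_all add: w_def power2_eq_square field_simps)
    also have "t * t / A x x = (\<Sum>a\<in>B. \<Sum>b\<in>B. v a * (A x a * A x b / A x x) * v b)"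
      unfolding t_def sum_product by (simp add: sum_divide_distrib mult_ac)
    also have "(\<Sum>a\<in>B. \<Sum>b\<in>B. v a * A a b * v b) - \<dots> = (\<Sum>a\<in>B. \<Sum>b\<in>B. v a * ?S a b * v b)"
      by (simp add: sum_subtractf algebra_simps)
    finally show "0 \<le> (\<Sum>a\<in>B. \<Sum>b\<in>B. v a * ?S a b * v b)" .
  qed
  from insert.IH[OF this] obtain N :: nat and q where
    q: "\<And>a b. a \<in> B \<Longrightarrow> b \<in> B \<Longrightarrow> ?S a b = (\<Sum>k<N. q k a * q k b)" by blast
  \<comment> \<open>The new vector, row \<open>x\<close> divided by \<open>sqrt (A x x)\<close>,
    restores the subtracted term; the old vectors are extended by 0 at \<open>x\<close>.\<close>
  define q' where "q' = (\<lambda>k b. if k = N then A x b / sqrt (A x x) else if b = x then 0 else q k b)"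
  have "A a b = (\<Sum>k<Suc N. q' k a * q' k b)" if ab: "a \<in> insert x B" "b \<in> insert x B" for a b
  proof -
    have last: "q' N a * q' N b = A x a * A x b / A x x"
      using pos by (simp add: q'_def)
    \<comment> \<open>The cancellation survives \<open>A x x = 0\<close> because row
      \<open>x\<close> then vanishes.\<close>
    have x: "A x x * A x c / A x x = A x c" if "c \<in> insert x B" for c
      using row0[OF _ that] by (cases "A x x = 0") auto
    show ?thesis
    proof (cases "a = x \<or> b = x")
      case True
      then have "(\<Sum>k<N. q' k a * q' k b) = 0"
        by (auto simp: q'_def intro!: sum.neutral)
      moreover have "A a b = A x a * A x b / A x x"
        using True x[of a] x[of b] sym[OF ab] ab by (metis mult.commute)
      ultimately show ?thesis using last by simp
    next
      case False
      then have "(\<Sum>k<N. q' k a * q' k b) = (\<Sum>k<N. q k a * q k b)"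
        by (auto simp: q'_def intro!: sum.cong)
      then show ?thesis using last q[of a b] ab False by simp
    qed
  qed
  then show ?case by blast
qed

lemma psd_on_rank_one: "psd_on B (\<lambda>a b. v a * v b)"
proof -
  have "(\<Sum>a\<in>B. \<Sum>b\<in>B. w a * (v a * v b) * w b) = (\<Sum>a\<in>B. v a * w a)\<^sup>2" for w
    by (simp add: power2_eq_square sum_product mult_ac)
  then show ?thesis by (simp add: psd_on_def)
qed

lemma psd_on_add: "psd_on B A \<Longrightarrow> psd_on B A' \<Longrightarrow> psd_on B (\<lambda>a b. A a b + A' a b)"
  unfolding psd_on_def by (simp add: algebra_simps sum.distrib)

lemma psd_on_scale:
  assumes "psd_on B A" "0 \<le> s"
  shows "psd_on B (\<lambda>a b. s * A a b)"
proof -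
  have "(\<Sum>a\<in>B. \<Sum>b\<in>B. v a * (s * A a b) * v b) = s * (\<Sum>a\<in>B. \<Sum>b\<in>B. v a * A a b * v b)" for v
    by (simp add: sum_distrib_left mult_ac)
  with assms show ?thesis by (simp add: psd_on_def)
qed

lemma psd_on_zero: "psd_on B (\<lambda>_ _. 0)"
  by (simp add: psd_on_def)

lemma psd_on_cong:
  assumes "\<And>a b. a \<in> B \<Longrightarrow> b \<in> B \<Longrightarrow> A a b = A' a b"
  shows "psd_on B A \<longleftrightarrow> psd_on B A'"
  using assms by (simp add: psd_on_def)

text \<open>With \<open>A\<close> a sum of rank-one terms, the pairing is the sum of the values of
  the form \<open>M\<close> at the vectors \<open>q k\<close>, and the trace is the sum of their
  squared norms. Weak duality uses \<open>c = 0\<close>, coercivity \<open>c = 1/2\<close>.\<close>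

lemma psd_on_pairing_ge_trace:
  fixes A M :: "'b \<Rightarrow> 'b \<Rightarrow> real"
  assumes "finite B" "psd_on B A"
    and M: "\<And>v. c * (\<Sum>a\<in>B. (v a)\<^sup>2) \<le> (\<Sum>a\<in>B. \<Sum>b\<in>B. v a * M a b * v b)"
  shows "c * (\<Sum>a\<in>B. A a a) \<le> (\<Sum>a\<in>B. \<Sum>b\<in>B. A a b * M a b)"
proof -
  obtain N :: nat and q where
    q: "\<And>a b. a \<in> B \<Longrightarrow> b \<in> B \<Longrightarrow> A a b = (\<Sum>k<N. q k a * q k b)"
    using psd_on_rank_one_decomposition[OF assms(1,2)] by blast
  have "c * (\<Sum>a\<in>B. A a a) = c * (\<Sum>a\<in>B. \<Sum>k<N. (q k a)\<^sup>2)"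
    by (simp add: q power2_eq_square)
  also have "\<dots> = (\<Sum>k<N. c * (\<Sum>a\<in>B. (q k a)\<^sup>2))"
    by (subst sum.swap) (simp add: sum_distrib_left)
  also have "\<dots> \<le> (\<Sum>k<N. \<Sum>a\<in>B. \<Sum>b\<in>B. q k a * M a b * q k b)"
    by (intro sum_mono M)
  also have "\<dots> = (\<Sum>a\<in>B. \<Sum>b\<in>B. \<Sum>k<N. q k a * M a b * q k b)"
    by (subst sum.swap, intro sum.cong refl, rule sum.swap)
  also have "\<dots> = (\<Sum>a\<in>B. \<Sum>b\<in>B. A a b * M a b)"
    by (intro sum.cong refl) (simp add: q sum_distrib_left mult_ac)
  finally show ?thesis .
qed

text \<open>AM-GM on each rank-one term bounds an entry by the mean of two diagonal entries, so a
  bound on the trace confines the whole matrix.\<close>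

lemma psd_on_abs_le_trace:
  fixes A :: "'b \<Rightarrow> 'b \<Rightarrow> real"
  assumes "finite B" "psd_on B A" "a \<in> B" "b \<in> B"
  shows "\<bar>A a b\<bar> \<le> (\<Sum>a\<in>B. A a a)"
proof -
  obtain N :: nat and q where
    q: "\<And>a b. a \<in> B \<Longrightarrow> b \<in> B \<Longrightarrow> A a b = (\<Sum>k<N. q k a * q k b)"
    using psd_on_rank_one_decomposition[OF assms(1,2)] by blast
  have "\<bar>A a b\<bar> \<le> (\<Sum>k<N. \<bar>q k a * q k b\<bar>)"
    using q assms by (simp add: sum_abs)
  also have "\<dots> \<le> (\<Sum>k<N. (q k a * q k a + q k b * q k b) / 2)"
  proof (rule sum_mono)
    fix k
    show "\<bar>q k a * q k b\<bar> \<le> (q k a * q k a + q k b * q k b) / 2"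
      using sum_squares_bound[of "\<bar>q k a\<bar>" "\<bar>q k b\<bar>"] by (simp add: abs_mult power2_eq_square)
  qed
  also have "\<dots> = (A a a + A b b) / 2"
    using q assms by (simp add: sum.distrib flip: sum_divide_distrib)
  \<comment> \<open>Bounding the two diagonal entries separately by the trace also covers
    \<open>a = b\<close>.\<close>
  also have "\<dots> \<le> (\<Sum>a\<in>B. A a a)"
    using member_le_sum[of a B "\<lambda>a. A a a"] member_le_sum[of b B "\<lambda>a. A a a"]
      psd_on_diag_nonneg[OF assms(1,2)] assms by fastforce
  finally show ?thesis .
qed

subsection \<open>Separation from a coercive cone\<close>

text \<open>Minimise the squared distance from \<open>g\<close> to the image cone; coercivity confines the
  minimisation to a compact box, and the residual at the minimiser separates.\<close>

lemma coercive_cone_separation: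
  fixes K :: "('b \<Rightarrow> real) set" and c :: "'a \<Rightarrow> 'b \<Rightarrow> real" and g l :: "'a \<Rightarrow> real"
  assumes fin: "finite B" "finite F"
    and K: "closed K" "(\<lambda>_. 0) \<in> K"
      "\<And>V W. V \<in> K \<Longrightarrow> W \<in> K \<Longrightarrow> (\<lambda>b. V b + W b) \<in> K"
      "\<And>s W. 0 \<le> s \<Longrightarrow> W \<in> K \<Longrightarrow> (\<lambda>b. s * W b) \<in> K"
      "\<And>W b. W \<in> K \<Longrightarrow> b \<notin> B \<Longrightarrow> W b = 0"
    and coercive: "\<And>W b. W \<in> K \<Longrightarrow> b \<in> B \<Longrightarrow> \<bar>W b\<bar> \<le> (\<Sum>a\<in>F. l a * (\<Sum>b\<in>B. c a b * W b))"
    and notin: "\<And>W. W \<in> K \<Longrightarrow> \<exists>a\<in>F. (\<Sum>b\<in>B. c a b * W b) \<noteq> g a"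
  obtains r where "\<And>W. W \<in> K \<Longrightarrow> 0 \<le> (\<Sum>a\<in>F. r a * (\<Sum>b\<in>B. c a b * W b))"
    and "(\<Sum>a\<in>F. r a * g a) < 0"
proof -
  define G where "G W a = (\<Sum>b\<in>B. c a b * W b)" for W a
  define \<Phi> where "\<Phi> W = (\<Sum>a\<in>F. (G W a - g a)\<^sup>2)" for W
  \<comment> \<open>\<open>M\<close> is the squared distance from the image of 0; \<open>R\<close>
    is the coordinate bound that coercivity gives to all points of the cone at least as
    close.\<close>
  define M where "M = \<Phi> (\<lambda>_. 0)"
  define R where "R = (\<Sum>a\<in>F. \<bar>l a\<bar> * (sqrt M + \<bar>g a\<bar>))"
  define S where "S = K \<inter> (UNIV \<rightarrow>\<^sub>E {-R..R})"
  have G_add: "G (\<lambda>b. V b + W b) a = G V a + G W a" for V W a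
    by (simp add: G_def algebra_simps sum.distrib)
  have G_scale: "G (\<lambda>b. s * W b) a = s * G W a" for s W a
    by (simp add: G_def sum_distrib_left mult_ac)
  have coord: "continuous_on A (\<lambda>W. W b)" for A :: "('b \<Rightarrow> real) set" and b
    by (rule continuous_on_subset[OF continuous_on_product_coordinates]) simp
  have "R \<ge> 0"
    unfolding R_def by (intro sum_nonneg mult_nonneg_nonneg add_nonneg_nonneg)
      (auto simp: M_def \<Phi>_def intro!: sum_nonneg)
  \<comment> \<open>Tychonoff: the box is compact in the product topology, even for an infinite
    index type.\<close>
  have "compactin (product_topology (\<lambda>_. euclidean) UNIV) (UNIV \<rightarrow>\<^sub>E {-R..R} :: ('b \<Rightarrow> real) set)"
    by (simp add: compactin_PiE)
  then have "compact (UNIV \<rightarrow>\<^sub>E {-R..R} :: ('b \<Rightarrow> real) set)"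
    by (simp add: euclidean_product_topology)
  then have "compact S"
    unfolding S_def using K(1) by (simp add: closed_Int_compact)
  moreover have "(\<lambda>_. 0) \<in> S"
    using K(2) \<open>R \<ge> 0\<close> by (simp add: S_def PiE_def)
  moreover have "continuous_on S \<Phi>"
    unfolding \<Phi>_def G_def by (intro continuous_intros coord)
  ultimately obtain W0 where W0: "W0 \<in> S" "\<And>W. W \<in> S \<Longrightarrow> \<Phi> W0 \<le> \<Phi> W"
    using continuous_attains_inf[of S \<Phi>] by auto
  have sublevel: "W \<in> S" if "W \<in> K" "\<Phi> W \<le> M" for W
  proof -
    have "\<bar>G W a\<bar> \<le> sqrt M + \<bar>g a\<bar>" if "a \<in> F" for a
    proof -
      have "(G W a - g a)\<^sup>2 \<le> \<Phi> W"
        unfolding \<Phi>_def using fin that by (intro member_le_sum) auto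
      then have "\<bar>G W a - g a\<bar> \<le> sqrt M"
        using \<open>\<Phi> W \<le> M\<close> by (intro real_le_rsqrt) simp
      then show ?thesis by linarith
    qed
    then have "l a * G W a \<le> \<bar>l a\<bar> * (sqrt M + \<bar>g a\<bar>)" if "a \<in> F" for a
      using that by (intro order_trans[OF abs_ge_self[of "l a * G W a"]]) (simp add: abs_mult mult_left_mono)
    then have "(\<Sum>a\<in>F. l a * G W a) \<le> R"
      unfolding R_def by (rule sum_mono)
    then have "\<bar>W b\<bar> \<le> R" for b
      using coercive[OF that(1), of b] K(5)[OF that(1), of b] \<open>R \<ge> 0\<close>
      by (cases "b \<in> B") (auto simp: G_def)
    then have "W b \<in> {-R..R}" for b
      by (simp add: abs_le_iff minus_le_iff)
    then show ?thesis using that by (auto simp: S_def)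
  qed
  \<comment> \<open>Points outside the sublevel set are beaten by 0, which lies in \<open>S\<close>,
    so \<open>W0\<close> is optimal on all of \<open>K\<close>.\<close>
  have min: "\<Phi> W0 \<le> \<Phi> W" if "W \<in> K" for W
    using W0(2)[OF sublevel[OF that]] W0(2)[OF \<open>(\<lambda>_. 0) \<in> S\<close>] by (cases "\<Phi> W \<le> M") (auto simp: M_def)
  have "W0 \<in> K" using W0 by (simp add: S_def)
  define r where "r a = G W0 a - g a" for a
  \<comment> \<open>The change of the squared distance in the direction \<open>V\<close>; its linear
    part is the pairing with the residual.\<close>
  have step: "0 \<le> s * (2 * (\<Sum>a\<in>F. r a * G V a) + s * (\<Sum>a\<in>F. (G V a)\<^sup>2))"
    if "(\<lambda>b. W0 b + s * V b) \<in> K" for s V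
  proof -
    have "\<Phi> (\<lambda>b. W0 b + s * V b) = (\<Sum>a\<in>F. (r a + s * G V a)\<^sup>2)"
      by (simp add: \<Phi>_def G_add G_scale r_def algebra_simps)
    also have "\<dots> = \<Phi> W0 + s * (2 * (\<Sum>a\<in>F. r a * G V a) + s * (\<Sum>a\<in>F. (G V a)\<^sup>2))"
      by (simp add: \<Phi>_def r_def power2_eq_square algebra_simps sum.distrib sum_distrib_left sum_subtractf)
    finally show ?thesis using min[OF that] by simp
  qed
  have first_order: "0 \<le> p" if "\<And>s. 0 < s \<Longrightarrow> s \<le> 1 \<Longrightarrow> 0 \<le> s * (2 * p + s * q)" for p q :: real
  proof (rule ccontr)
    assume "\<not> 0 \<le> p"
    \<comment> \<open>Chosen so that \<open>s * q \<le> - p\<close>, whence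
      \<open>2 * p + s * q \<le> p < 0\<close>.\<close>
    define s where "s = min 1 (- p / (1 + \<bar>q\<bar>))"
    have s: "0 < s" "s \<le> 1" using \<open>\<not> 0 \<le> p\<close> by (auto simp: s_def field_simps)
    have "s * q \<le> s * (1 + \<bar>q\<bar>)" using s by (intro mult_left_mono) auto
    also have "\<dots> \<le> - p / (1 + \<bar>q\<bar>) * (1 + \<bar>q\<bar>)" by (intro mult_right_mono) (auto simp: s_def)
    also have "\<dots> = - p" by (simp add: field_simps)
    finally have "2 * p + s * q < 0" using \<open>\<not> 0 \<le> p\<close> by linarith
    then show False using that[OF s] s by (simp add: zero_le_mult_iff)
  qed
  show thesis
  proof
    fix W assume "W \<in> K"
    show "0 \<le> (\<Sum>a\<in>F. r a * (\<Sum>b\<in>B. c a b * W b))"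
      using first_order[OF step[of _ W]] K(3)[OF \<open>W0 \<in> K\<close> K(4)[OF _ \<open>W \<in> K\<close>]]
      by (simp add: G_def)
  next
    \<comment> \<open>The direction \<open>- W0\<close> stays in the cone for
      \<open>s \<le> 1\<close>, as \<open>(1 - s) * W0\<close>. Hence the residual pairs
      nonpositively with the image of \<open>W0\<close>; its pairing with \<open>g\<close> is
      smaller still by its squared norm.\<close>
    have "0 \<le> (\<Sum>a\<in>F. r a * G (\<lambda>b. - 1 * W0 b) a)"
    proof (rule first_order[OF step])
      fix s :: real assume "0 < s" "s \<le> 1"
      then show "(\<lambda>b. W0 b + s * (- 1 * W0 b)) \<in> K"
        using K(4)[OF _ \<open>W0 \<in> K\<close>, of "1 - s"] by (simp add: algebra_simps)
    qed
    then have "(\<Sum>a\<in>F. r a * G W0 a) \<le> 0"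
      unfolding G_scale by (simp add: sum_negf)
    moreover have "(\<Sum>a\<in>F. r a * g a) = (\<Sum>a\<in>F. r a * G W0 a) - (\<Sum>a\<in>F. (r a)\<^sup>2)"
      by (simp add: r_def power2_eq_square algebra_simps flip: sum_subtractf)
    moreover have "0 < (\<Sum>a\<in>F. (r a)\<^sup>2)"
    proof -
      obtain a where "a \<in> F" "r a \<noteq> 0"
        using notin[OF \<open>W0 \<in> K\<close>] by (auto simp: r_def G_def)
      then show ?thesis using fin by (intro sum_pos2[of F a]) auto
    qed
    ultimately show "(\<Sum>a\<in>F. r a * g a) < 0" by linarith
  qed
qed

subsection \<open>Linear functionals and sums of squares\<close>

text \<open>The Riesz functional, the linear extension of \<open>y\<close> from monomials to
  polynomials; both point evaluations and moment vectors are instances.\<close>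

definition riesz :: "('n expo \<Rightarrow> real) \<Rightarrow> 'n rpoly \<Rightarrow> real"
  where "riesz y p = (\<Sum>\<alpha>\<in>Poly_Mapping.keys p. coeff p \<alpha> * y \<alpha>)"

lemma riesz_eq_sum:
  assumes "finite S" "Poly_Mapping.keys p \<subseteq> S"
  shows "riesz y p = (\<Sum>\<alpha>\<in>S. coeff p \<alpha> * y \<alpha>)"
  unfolding riesz_def using assms by (intro sum.mono_neutral_left) (auto simp: in_keys_iff)

lemma riesz_zero [simp]: "riesz y 0 = 0"
  by (simp add: riesz_def)

lemma riesz_add: "riesz y (p + q) = riesz y p + riesz y q"
proof -
  let ?S = "Poly_Mapping.keys p \<union> Poly_Mapping.keys q"
  have "riesz y p' = (\<Sum>\<alpha>\<in>?S. coeff p' \<alpha> * y \<alpha>)" if "p' \<in> {p, q, p + q}" for p'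
    using that keys_add[of p q] by (intro riesz_eq_sum) auto
  then show ?thesis by (simp add: lookup_add algebra_simps sum.distrib)
qed

lemma riesz_diff: "riesz y (p - q) = riesz y p - riesz y q"
  using riesz_add[of y "p - q" q] by simp

lemma riesz_sum: "riesz y (\<Sum>i\<in>I. p i) = (\<Sum>i\<in>I. riesz y (p i))"
  by (induction I rule: infinite_finite_induct) (simp_all add: riesz_add)

lemma riesz_single [simp]: "riesz y (Poly_Mapping.single \<alpha> c) = c * y \<alpha>"
  using riesz_eq_sum[of "{\<alpha>}" "Poly_Mapping.single \<alpha> c" y] by (simp split: if_splits)

lemma riesz_const_poly [simp]: "riesz y (const_poly c) = c * y 0"
  by (simp add: const_poly_def)

lemma poly_mapping_sum_singles:
  "p = (\<Sum>\<alpha>\<in>Poly_Mapping.keys p. Poly_Mapping.single \<alpha> (Poly_Mapping.lookup p \<alpha>))"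
  by (rule poly_mapping_eqI) (simp add: lookup_sum lookup_single when_def in_keys_iff)

text \<open>A multiplicative \<open>y\<close> induces a ring homomorphism; in particular, evaluation
  at a point sends squares to squares.\<close>

lemma riesz_mult:
  assumes "\<And>\<alpha> \<beta>. y (\<alpha> + \<beta>) = y \<alpha> * y \<beta>"
  shows "riesz y (p * q) = riesz y p * riesz y q"
proof -
  have "riesz y (p * q) = riesz y
    ((\<Sum>\<alpha>\<in>Poly_Mapping.keys p. Poly_Mapping.single \<alpha> (coeff p \<alpha>)) *
     (\<Sum>\<beta>\<in>Poly_Mapping.keys q. Poly_Mapping.single \<beta> (coeff q \<beta>)))"
    by (simp flip: poly_mapping_sum_singles)
  also have "\<dots> = (\<Sum>\<alpha>\<in>Poly_Mapping.keys p. \<Sum>\<beta>\<in>Poly_Mapping.keys q.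
      coeff p \<alpha> * coeff q \<beta> * (y \<alpha> * y \<beta>))"
    by (simp add: sum_product mult_single riesz_sum assms)
  also have "\<dots> = riesz y p * riesz y q"
    by (simp add: riesz_def sum_product mult_ac)
  finally show ?thesis .
qed

lemma poly_eval_eq_riesz:
  "poly_eval p x = riesz (\<lambda>\<alpha>. \<Prod>j\<in>UNIV. (x $ j) ^ Poly_Mapping.lookup \<alpha> j) p"
  by (simp add: poly_eval_def riesz_def)

lemma poly_eval_diff_const: "poly_eval (f - const_poly c) x = poly_eval f x - c"
  by (simp add: poly_eval_eq_riesz riesz_diff)

section \<open>Sums of squares\<close>

lemma SOS_poly_eval_nonneg:
  assumes "SOS p"
  shows "0 \<le> poly_eval p x"
proof -
  obtain N :: nat and q where "p = (\<Sum>k<N. (q k)\<^sup>2)"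
    using assms by (auto simp: SOS_def)
  then have "poly_eval p x = (\<Sum>k<N. (poly_eval (q k) x)\<^sup>2)"
    by (simp add: poly_eval_eq_riesz riesz_sum power2_eq_square riesz_mult lookup_add power_add prod.distrib)
  then show ?thesis by (simp add: sum_nonneg)
qed

lemma f_sos_le_f_star: "f_sos f \<le> f_star f"
  unfolding f_sos_def f_star_def
  using SOS_poly_eval_nonneg by (force intro!: SUP_least INF_greatest simp: poly_eval_diff_const)

lemma SOS_zero: "SOS 0"
  unfolding SOS_def by (rule exI[of _ 0]) simp

lemma SOS_add_square:
  assumes "SOS p"
  shows "SOS (p + q\<^sup>2)"
proof -
  obtain N :: nat and r where "p = (\<Sum>k<N. (r k)\<^sup>2)"
    using assms by (auto simp: SOS_def)
  then have "p + q\<^sup>2 = (\<Sum>k<Suc N. ((r(N := q)) k)\<^sup>2)" by simp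
  then show ?thesis unfolding SOS_def by blast
qed

lemma SOS_add:
  assumes "SOS p" "SOS q"
  shows "SOS (p + q)"
proof -
  have "SOS (p + (\<Sum>k<N. (r k)\<^sup>2))" for N :: nat and r
  proof (induction N)
    case (Suc N)
    then show ?case using SOS_add_square[of _ "r N"] by (simp flip: add.assoc)
  qed (simp add: assms(1))
  then show ?thesis using assms(2) by (auto simp: SOS_def[of q])
qed

lemma SOS_sum: "(\<And>i. i \<in> I \<Longrightarrow> SOS (p i)) \<Longrightarrow> SOS (\<Sum>i\<in>I. p i)"
  by (induction I rule: infinite_finite_induct) (auto simp: SOS_zero intro: SOS_add)

subsection \<open>Gram polynomials and weak duality\<close>

lemma gram_poly_eq_singles:
  "gram_poly D d W = (\<Sum>\<alpha>\<in>expos D d. \<Sum>\<beta>\<in>expos D d. Poly_Mapping.single (\<alpha> + \<beta>) (W \<alpha> \<beta>))"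
  by (simp add: gram_poly_def monom_poly_def const_poly_def mult_single)

lemma coeff_gram_poly:
  "coeff (gram_poly D d W) \<gamma> = (\<Sum>\<alpha>\<in>expos D d. \<Sum>\<beta>\<in>expos D d. of_bool (\<alpha> + \<beta> = \<gamma>) * W \<alpha> \<beta>)"
  unfolding gram_poly_eq_singles lookup_sum
  by (intro sum.cong refl) (simp add: lookup_single when_def)

lemma riesz_gram_poly:
  "riesz y (gram_poly D d W) = (\<Sum>\<alpha>\<in>expos D d. \<Sum>\<beta>\<in>expos D d. W \<alpha> \<beta> * moment_matrix y \<alpha> \<beta>)"
  by (simp add: gram_poly_eq_singles riesz_sum moment_matrix_def)

text \<open>Each rank-one term of \<open>W\<close> contributes the square of the polynomial with
  coefficient vector \<open>q k\<close>.\<close>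

lemma SOS_gram_poly:
  assumes "psd_on (expos D d) W"
  shows "SOS (gram_poly D d W)"
proof -
  obtain N :: nat and q where
    q: "\<And>\<alpha> \<beta>. \<alpha> \<in> expos D d \<Longrightarrow> \<beta> \<in> expos D d \<Longrightarrow> W \<alpha> \<beta> = (\<Sum>k<N. q k \<alpha> * q k \<beta>)"
    using psd_on_rank_one_decomposition[OF finite_expos assms] by blast
  have "gram_poly D d W = (\<Sum>\<alpha>\<in>expos D d. \<Sum>\<beta>\<in>expos D d. \<Sum>k<N.
      Poly_Mapping.single \<alpha> (q k \<alpha>) * Poly_Mapping.single \<beta> (q k \<beta>))"
    unfolding gram_poly_eq_singles
    by (intro sum.cong refl) (simp add: q mult_single, rule poly_mapping_eqI,
        simp add: lookup_sum lookup_single when_def)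
  also have "\<dots> = (\<Sum>k<N. \<Sum>\<alpha>\<in>expos D d. \<Sum>\<beta>\<in>expos D d.
      Poly_Mapping.single \<alpha> (q k \<alpha>) * Poly_Mapping.single \<beta> (q k \<beta>))"
    by (subst (2) sum.swap, intro sum.cong refl, rule sum.swap)
  also have "\<dots> = (\<Sum>k<N. (\<Sum>\<alpha>\<in>expos D d. Poly_Mapping.single \<alpha> (q k \<alpha>))\<^sup>2)"
    by (simp add: power2_eq_square sum_product)
  finally show ?thesis unfolding SOS_def by (intro exI)
qed

lemma f_Delta_le_f_sos: "f_Delta m \<Delta> d f \<le> f_sos f"
  unfolding f_Delta_def f_sos_def
  by (rule SUP_subset_mono) (auto intro!: SOS_sum SOS_gram_poly)

section \<open>Exponents of the cliques and the support of the polynomial\<close>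

lemma expo_deg_add: "expo_deg (\<alpha> + \<beta>) = expo_deg \<alpha> + expo_deg \<beta>"
  by (simp add: expo_deg_def lookup_add sum.distrib)

lemma expos_add: "\<alpha> \<in> expos D k \<Longrightarrow> \<beta> \<in> expos D l \<Longrightarrow> \<alpha> + \<beta> \<in> expos D (k + l)"
  using keys_add[of \<alpha> \<beta>] by (fastforce simp: expos_def expo_deg_add)

lemma zero_in_expos: "0 \<in> expos D k"
  by (simp add: expos_def expo_deg_def)

text \<open>Guarantees that restricting a moment vector to \<open>sparse_expos\<close> leaves the
  moment matrices of the cliques unchanged.\<close>

lemma expos_add_in_sparse_expos:
  "i \<in> {1..m} \<Longrightarrow> \<alpha> \<in> expos (\<Delta> i) d \<Longrightarrow> \<beta> \<in> expos (\<Delta> i) d \<Longrightarrow> \<alpha> + \<beta> \<in> sparse_expos m \<Delta> d"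
  unfolding sparse_expos_def using expos_add[of \<alpha> "\<Delta> i" d \<beta> d] by (auto simp: mult_2)

lemma finite_sparse_expos: "finite (sparse_expos m \<Delta> d)"
  by (simp add: sparse_expos_def finite_expos)

lemma expo_deg_le_total_degree: "\<alpha> \<in> Poly_Mapping.keys p \<Longrightarrow> expo_deg \<alpha> \<le> total_degree p"
  by (simp add: total_degree_def)

lemma keys_subset_sparse_expos:
  assumes "f = (\<Sum>i=1..m. fi i)"
    and "\<And>i. i \<in> {1..m} \<Longrightarrow> fi i \<in> polys_in (\<Delta> i)"
    and "\<And>i. i \<in> {1..m} \<Longrightarrow> total_degree (fi i) \<le> 2 * d"
  shows "Poly_Mapping.keys f \<subseteq> sparse_expos m \<Delta> d"
proof
  fix \<alpha> assume "\<alpha> \<in> Poly_Mapping.keys f"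
  then obtain i where i: "i \<in> {1..m}" "\<alpha> \<in> Poly_Mapping.keys (fi i)"
    using keys_sum[of fi "{1..m}"] assms(1) by auto
  then have "\<alpha> \<in> expos (\<Delta> i) (2 * d)"
    using assms(2,3)[OF i(1)] expo_deg_le_total_degree[OF i(2)] by (auto simp: polys_in_def expos_def)
  then show "\<alpha> \<in> sparse_expos m \<Delta> d" using i by (auto simp: sparse_expos_def)
qed

text \<open>Weak duality: the Riesz functional of a feasible \<open>y\<close> turns the Gram
  identity into a sum of nonnegative matrix pairings, and \<open>y 0 = 1\<close> makes its left side
  the moment value minus \<gamma>.\<close>

lemma f_Delta_le_f_Sigma:
  assumes keys: "Poly_Mapping.keys f \<subseteq> sparse_expos m \<Delta> d"
  shows "f_Delta m \<Delta> d f \<le> f_Sigma m \<Delta> d f"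
  unfolding f_Delta_def f_Sigma_def
proof (intro SUP_least INF_greatest, clarify)
  fix \<gamma> W y
  assume W: "\<forall>i\<in>{1..m}. psd_on (expos (\<Delta> i) d) (W i)"
    and eq: "f - const_poly \<gamma> = (\<Sum>i=1..m. gram_poly (\<Delta> i) d (W i))"
    and y: "\<forall>i\<in>{1..m}. psd_on (expos (\<Delta> i) d) (moment_matrix y)" "y 0 = 1"
  have "0 \<le> riesz y (gram_poly (\<Delta> i) d (W i))" if "i \<in> {1..m}" for i
    using psd_on_pairing_ge_trace[OF finite_expos, of "\<Delta> i" d "W i" 0 "moment_matrix y"] W y that
      psd_onD_nonneg[of "expos (\<Delta> i) d" "moment_matrix y"]
    by (simp add: riesz_gram_poly)
  then have "0 \<le> riesz y (f - const_poly \<gamma>)"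
    unfolding eq riesz_sum by (rule sum_nonneg)
  then show "ereal \<gamma> \<le> ereal (\<Sum>\<alpha>\<in>sparse_expos m \<Delta> d. coeff f \<alpha> * y \<alpha>)"
    using y by (simp add: riesz_diff riesz_eq_sum[OF finite_sparse_expos keys])
qed

subsection \<open>Strictly positive moments\<close>

text \<open>With \<open>y \<alpha> = t ^ (\<Sum>j. \<alpha>\<^sub>j\<^sup>2)\<close> the normalised entries of the moment matrix are
  \<open>t ^ - (\<Sum>j. (\<alpha>\<^sub>j - \<beta>\<^sub>j)\<^sup>2)\<close>, so it is diagonally dominant for large \<open>t\<close>.\<close>

definition expo_sqnorm :: "'n::finite expo \<Rightarrow> nat"
  where "expo_sqnorm \<alpha> = (\<Sum>j\<in>UNIV. (Poly_Mapping.lookup \<alpha> j)\<^sup>2)"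

lemma expo_sqnorm_double: "expo_sqnorm (\<alpha> + \<alpha>) = 2 * expo_sqnorm \<alpha> + 2 * expo_sqnorm \<alpha>"
proof -
  have "(a + a)\<^sup>2 = 2 * a\<^sup>2 + 2 * a\<^sup>2" for a :: nat
    by (simp add: power2_eq_square algebra_simps)
  then show ?thesis
    by (simp only: expo_sqnorm_def lookup_add sum.distrib sum_distrib_left)
qed

text \<open>Coordinatewise \<open>(a + b)^2 = 2 * a^2 + 2 * b^2 - (a - b)^2\<close>. Strictness
  between naturals provides a full spare factor \<open>t\<close> for the off-diagonal
  moments.\<close>

lemma expo_sqnorm_add_less:
  assumes "\<alpha> \<noteq> \<beta>"
  shows "expo_sqnorm (\<alpha> + \<beta>) < 2 * expo_sqnorm \<alpha> + 2 * expo_sqnorm \<beta>"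
proof -
  have less: "(a + b)\<^sup>2 < 2 * a\<^sup>2 + 2 * b\<^sup>2" if "a \<noteq> b" for a b :: nat
  proof -
    have "0 < (int a - int b)\<^sup>2" using that by simp
    also have "\<dots> = 2 * (int a)\<^sup>2 + 2 * (int b)\<^sup>2 - (int a + int b)\<^sup>2"
      by (simp add: power2_eq_square algebra_simps)
    finally have "int ((a + b)\<^sup>2) < int (2 * a\<^sup>2 + 2 * b\<^sup>2)"
      by (simp only: of_nat_add of_nat_mult of_nat_power of_nat_numeral less_diff_eq)
    then show ?thesis by (simp only: of_nat_less_iff)
  qed
  have le: "(a + b)\<^sup>2 \<le> 2 * a\<^sup>2 + 2 * b\<^sup>2" for a b :: nat
  proof (cases "a = b")
    case True
    then show ?thesis by (simp add: power2_eq_square algebra_simps)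
  next
    case False
    then show ?thesis by (rule less_imp_le[OF less])
  qed
  obtain j where "Poly_Mapping.lookup \<alpha> j \<noteq> Poly_Mapping.lookup \<beta> j"
    using assms by (auto simp: poly_mapping_eq_iff fun_eq_iff)
  then have "expo_sqnorm (\<alpha> + \<beta>) <
      (\<Sum>j\<in>UNIV. 2 * (Poly_Mapping.lookup \<alpha> j)\<^sup>2 + 2 * (Poly_Mapping.lookup \<beta> j)\<^sup>2)"
    unfolding expo_sqnorm_def lookup_add
    by (intro sum_strict_mono_ex1 ballI le bexI[of _ j] less) simp_all
  then show ?thesis by (simp add: expo_sqnorm_def sum.distrib sum_distrib_left)
qed

lemma strictly_positive_moments:
  fixes B :: "'n::finite expo set" and t :: real
  assumes "finite B" "2 * real (card B) \<le> t" "1 \<le> t"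
  shows "1/2 * (\<Sum>\<alpha>\<in>B. (v \<alpha>)\<^sup>2) \<le>
    (\<Sum>\<alpha>\<in>B. \<Sum>\<beta>\<in>B. v \<alpha> * moment_matrix (\<lambda>\<alpha>. t ^ expo_sqnorm \<alpha>) \<alpha> \<beta> * v \<beta>)"
proof -
  \<comment> \<open>This rescaling turns every diagonal entry into 1.\<close>
  define u where "u \<alpha> = v \<alpha> * t ^ (2 * expo_sqnorm \<alpha>)" for \<alpha>
  \<comment> \<open>AM-GM bounds the off-diagonal terms. Subtracting the same bound on the diagonal
    gives one formula for all pairs, easy to sum.\<close>
  have termwise: "of_bool (\<alpha> = \<beta>) * (u \<alpha>)\<^sup>2 - ((u \<alpha>)\<^sup>2 + (u \<beta>)\<^sup>2) / (2 * t)
      \<le> v \<alpha> * t ^ expo_sqnorm (\<alpha> + \<beta>) * v \<beta>" for \<alpha> \<beta> :: "'n expo"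
  proof (cases "\<alpha> = \<beta>")
    case True
    have "t ^ expo_sqnorm (\<alpha> + \<alpha>) = t ^ (2 * expo_sqnorm \<alpha>) * t ^ (2 * expo_sqnorm \<alpha>)"
      by (simp only: expo_sqnorm_double power_add)
    then have "v \<alpha> * t ^ expo_sqnorm (\<alpha> + \<beta>) * v \<beta> = (u \<alpha>)\<^sup>2"
      using True by (simp add: u_def power2_eq_square)
    moreover have "0 \<le> ((u \<alpha>)\<^sup>2 + (u \<beta>)\<^sup>2) / (2 * t)" using assms by simp
    ultimately show ?thesis using True by simp
  next
    case False
    have "t ^ expo_sqnorm (\<alpha> + \<beta>) * t \<le> t ^ (2 * expo_sqnorm \<alpha> + 2 * expo_sqnorm \<beta>)"
      using expo_sqnorm_add_less[OF False] assms power_increasing[of "Suc (expo_sqnorm (\<alpha> + \<beta>))"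
        "2 * expo_sqnorm \<alpha> + 2 * expo_sqnorm \<beta>" t] by (simp add: mult.commute)
    then have "\<bar>v \<alpha> * v \<beta>\<bar> * (t ^ expo_sqnorm (\<alpha> + \<beta>) * t)
        \<le> \<bar>v \<alpha> * v \<beta>\<bar> * t ^ (2 * expo_sqnorm \<alpha> + 2 * expo_sqnorm \<beta>)"
      by (rule mult_left_mono) simp
    also have "\<dots> = \<bar>u \<alpha>\<bar> * \<bar>u \<beta>\<bar>"
      using assms by (simp add: u_def abs_mult power_add)
    also have "\<dots> \<le> ((u \<alpha>)\<^sup>2 + (u \<beta>)\<^sup>2) / 2"
      using sum_squares_bound[of "\<bar>u \<alpha>\<bar>" "\<bar>u \<beta>\<bar>"] by simp
    finally have "\<bar>v \<alpha> * v \<beta>\<bar> * t ^ expo_sqnorm (\<alpha> + \<beta>) \<le> ((u \<alpha>)\<^sup>2 + (u \<beta>)\<^sup>2) / (2 * t)"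
      using assms by (simp add: field_simps)
    moreover have "\<bar>v \<alpha> * v \<beta>\<bar> * t ^ expo_sqnorm (\<alpha> + \<beta>) = \<bar>v \<alpha> * t ^ expo_sqnorm (\<alpha> + \<beta>) * v \<beta>\<bar>"
      using assms by (simp add: abs_mult)
    ultimately show ?thesis using False by simp
  qed
  have "(\<Sum>\<alpha>\<in>B. (v \<alpha>)\<^sup>2) \<le> (\<Sum>\<alpha>\<in>B. (u \<alpha>)\<^sup>2)"
  proof (rule sum_mono)
    fix \<alpha> :: "'n expo"
    have "1 \<le> t ^ (2 * expo_sqnorm \<alpha>)" using assms by (intro one_le_power)
    then have "\<bar>v \<alpha>\<bar> * 1 \<le> \<bar>v \<alpha>\<bar> * t ^ (2 * expo_sqnorm \<alpha>)" by (intro mult_left_mono) auto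
    then show "(v \<alpha>)\<^sup>2 \<le> (u \<alpha>)\<^sup>2"
      using assms by (intro abs_le_square_iff[THEN iffD1]) (simp add: u_def abs_mult)
  qed
  then have "1/2 * (\<Sum>\<alpha>\<in>B. (v \<alpha>)\<^sup>2) \<le> 1/2 * (\<Sum>\<alpha>\<in>B. (u \<alpha>)\<^sup>2)" by simp
  \<comment> \<open>Diagonal dominance: the subtracted terms total \<open>card B / t\<close>, at
    most 1/2, times the sum of squares.\<close>
  also have "\<dots> \<le> (1 - card B / t) * (\<Sum>\<alpha>\<in>B. (u \<alpha>)\<^sup>2)"
    using assms by (intro mult_right_mono sum_nonneg) (auto simp: field_simps)
  also have "\<dots> = (\<Sum>\<alpha>\<in>B. \<Sum>\<beta>\<in>B. of_bool (\<alpha> = \<beta>) * (u \<alpha>)\<^sup>2 - ((u \<alpha>)\<^sup>2 + (u \<beta>)\<^sup>2) / (2 * t))"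
  proof -
    have "(\<Sum>\<beta>\<in>B. of_bool (\<alpha> = \<beta>) * (u \<alpha>)\<^sup>2) = (u \<alpha>)\<^sup>2" if "\<alpha> \<in> B" for \<alpha>
    proof -
      have "(\<Sum>\<beta>\<in>B. of_bool (\<alpha> = \<beta>) * (u \<alpha>)\<^sup>2) = (\<Sum>\<beta>\<in>B. if \<alpha> = \<beta> then (u \<alpha>)\<^sup>2 else 0)"
        by (intro sum.cong) auto
      then show ?thesis using assms that by simp
    qed
    then have "(\<Sum>\<alpha>\<in>B. \<Sum>\<beta>\<in>B. of_bool (\<alpha> = \<beta>) * (u \<alpha>)\<^sup>2) = (\<Sum>\<alpha>\<in>B. (u \<alpha>)\<^sup>2)"
      by simp
    moreover have "(\<Sum>\<alpha>\<in>B. \<Sum>\<beta>\<in>B. ((u \<alpha>)\<^sup>2 + (u \<beta>)\<^sup>2) / (2 * t)) = card B / t * (\<Sum>\<alpha>\<in>B. (u \<alpha>)\<^sup>2)"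
      by (simp add: sum.distrib flip: sum_divide_distrib sum_distrib_left)
    ultimately show ?thesis by (simp add: sum_subtractf algebra_simps)
  qed
  also have "\<dots> \<le> (\<Sum>\<alpha>\<in>B. \<Sum>\<beta>\<in>B. v \<alpha> * moment_matrix (\<lambda>\<alpha>. t ^ expo_sqnorm \<alpha>) \<alpha> \<beta> * v \<beta>)"
    unfolding moment_matrix_def by (intro sum_mono termwise)
  finally show ?thesis .
qed

subsection \<open>Strong duality\<close>

lemma expo_add_eq_zero_iff: "\<alpha> + \<beta> = 0 \<longleftrightarrow> \<alpha> = 0 \<and> \<beta> = (0 :: 'n expo)"
  by (auto simp: poly_mapping_eq_iff fun_eq_iff lookup_add)

text \<open>These are the moments of the point mass at the origin. Exponents are nonnegative, so
  \<open>\<alpha> + \<beta> = 0\<close> only if both vanish, and the matrix has rank one.\<close>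

lemma psd_on_moments_at_origin: "psd_on B (moment_matrix (\<lambda>\<alpha>. of_bool (\<alpha> = 0)))"
proof -
  have "moment_matrix (\<lambda>\<alpha>. of_bool (\<alpha> = 0)) = (\<lambda>\<alpha> \<beta> :: 'a expo. of_bool (\<alpha> = 0) * of_bool (\<beta> = 0) :: real)"
    by (simp add: fun_eq_iff moment_matrix_def expo_add_eq_zero_iff)
  then show ?thesis by (simp only: psd_on_rank_one)
qed

text \<open>Families of Gram matrices as one vector, indexed by the clique and the matrix position.\<close>

definition gram_index :: "nat \<Rightarrow> (nat \<Rightarrow> 'n::finite set) \<Rightarrow> nat \<Rightarrow> (nat \<times> 'n expo \<times> 'n expo) set"
  where "gram_index m \<Delta> d = Sigma {1..m} (\<lambda>i. expos (\<Delta> i) d \<times> expos (\<Delta> i) d)"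

text \<open>Entries off the index set are pinned to 0, so that bounding the indexed entries confines
  a family to a compact box of the function space.\<close>

definition gram_cone ::
    "nat \<Rightarrow> (nat \<Rightarrow> 'n::finite set) \<Rightarrow> nat \<Rightarrow> (nat \<times> 'n expo \<times> 'n expo \<Rightarrow> real) set"
  where "gram_cone m \<Delta> d =
    {W. (\<forall>b. b \<notin> gram_index m \<Delta> d \<longrightarrow> W b = 0) \<and>
        (\<forall>i\<in>{1..m}. psd_on (expos (\<Delta> i) d) (\<lambda>\<alpha> \<beta>. W (i, \<alpha>, \<beta>)))}"

section \<open>Properties of the cone of Gram families\<close>

lemma finite_gram_index: "finite (gram_index m \<Delta> d)"
  by (simp add: gram_index_def finite_expos)

lemma sum_gram_index:
  "(\<Sum>b\<in>gram_index m \<Delta> d. h b) = (\<Sum>i=1..m. \<Sum>\<alpha>\<in>expos (\<Delta> i) d. \<Sum>\<beta>\<in>expos (\<Delta> i) d. h (i, \<alpha>, \<beta>))"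
  by (simp add: gram_index_def sum.Sigma sum.cartesian_product finite_expos split_def)

lemma closed_gram_cone: "closed (gram_cone m \<Delta> d)"
proof -
  have coord: "continuous_on UNIV (\<lambda>W. W b)" for b :: "nat \<times> 'a expo \<times> 'a expo"
    by (rule continuous_on_product_coordinates)
  show ?thesis
    unfolding gram_cone_def psd_on_def Ball_def
    by (intro closed_Collect_conj closed_Collect_all closed_Collect_imp open_Collect_const
        closed_Collect_eq closed_Collect_le continuous_intros coord)
qed

text \<open>Adjointness: pairing \<open>r\<close> with the coefficients produced by a Gram family
  amounts to pairing the Gram matrices with the moment matrices of \<open>r\<close>.\<close>

lemma sum_moments_gram_index:
  assumes "W \<in> gram_cone m \<Delta> d"
  shows "(\<Sum>\<gamma>\<in>sparse_expos m \<Delta> d. r \<gamma> *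
      (\<Sum>b\<in>gram_index m \<Delta> d. of_bool (fst (snd b) + snd (snd b) = \<gamma>) * W b)) =
    (\<Sum>i=1..m. \<Sum>\<alpha>\<in>expos (\<Delta> i) d. \<Sum>\<beta>\<in>expos (\<Delta> i) d. W (i, \<alpha>, \<beta>) * moment_matrix r \<alpha> \<beta>)"
proof -
  have "(\<Sum>\<gamma>\<in>sparse_expos m \<Delta> d. r \<gamma> *
      (\<Sum>b\<in>gram_index m \<Delta> d. of_bool (fst (snd b) + snd (snd b) = \<gamma>) * W b)) =
    (\<Sum>b\<in>gram_index m \<Delta> d. \<Sum>\<gamma>\<in>sparse_expos m \<Delta> d.
      if fst (snd b) + snd (snd b) = \<gamma> then r \<gamma> * W b else 0)"
    unfolding sum_distrib_left by (subst sum.swap) (auto intro!: sum.cong)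
  \<comment> \<open>For each index exactly one \<gamma> survives, and it lies in
    \<open>sparse_expos\<close>.\<close>
  also have "\<dots> = (\<Sum>b\<in>gram_index m \<Delta> d. W b * moment_matrix r (fst (snd b)) (snd (snd b)))"
    using expos_add_in_sparse_expos[of _ m _ \<Delta> d]
    by (intro sum.cong refl) (auto simp: finite_sparse_expos moment_matrix_def gram_index_def)
  also have "\<dots> = (\<Sum>i=1..m. \<Sum>\<alpha>\<in>expos (\<Delta> i) d. \<Sum>\<beta>\<in>expos (\<Delta> i) d.
      W (i, \<alpha>, \<beta>) * moment_matrix r \<alpha> \<beta>)"
    by (simp add: sum_gram_index)
  finally show ?thesis .
qed

text \<open>Test families living on the single clique \<open>j\<close>: nonnegativity of a
  functional on them makes its moment matrix for \<open>j\<close> positive semidefinite.\<close>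

lemma rank_one_in_gram_cone:
  "(\<lambda>(i, \<alpha>, \<beta>). if i = j \<and> (i, \<alpha>, \<beta>) \<in> gram_index m \<Delta> d then v \<alpha> * v \<beta> else 0) \<in> gram_cone m \<Delta> d"
proof -
  have "psd_on (expos (\<Delta> i) d)
      (\<lambda>\<alpha> \<beta>. if i = j \<and> (i, \<alpha>, \<beta>) \<in> gram_index m \<Delta> d then v \<alpha> * v \<beta> else 0)"
    if "i \<in> {1..m}" for i
  proof (cases "i = j")
    case True
    then show ?thesis
      using psd_on_rank_one[of "expos (\<Delta> i) d" v] that
      by (subst psd_on_cong[where A' = "\<lambda>\<alpha> \<beta>. v \<alpha> * v \<beta>"]) (auto simp: gram_index_def)
  qed (simp add: psd_on_zero)
  then show ?thesis by (auto simp: gram_cone_def)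
qed

text \<open>An entry is at most the trace of its block, hence at most the sum of all traces; each
  trace is at most twice the pairing with the strictly positive moments, and adjointness rewrites
  the total in coefficients.\<close>

lemma gram_cone_coercive:
  fixes \<Delta> :: "nat \<Rightarrow> 'n::finite set" and t :: real
  assumes t: "2 * real (card (expos (UNIV :: 'n set) d)) \<le> t" "1 \<le> t"
    and W: "W \<in> gram_cone m \<Delta> d" and b: "b \<in> gram_index m \<Delta> d"
  shows "\<bar>W b\<bar> \<le> (\<Sum>\<gamma>\<in>sparse_expos m \<Delta> d. 2 * t ^ expo_sqnorm \<gamma> *
      (\<Sum>b\<in>gram_index m \<Delta> d. of_bool (fst (snd b) + snd (snd b) = \<gamma>) * W b))"
proof -
  let ?M = "moment_matrix (\<lambda>\<gamma>. t ^ expo_sqnorm \<gamma>)"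
  let ?tr = "\<lambda>i. \<Sum>\<alpha>\<in>expos (\<Delta> i) d. W (i, \<alpha>, \<alpha>)"
  obtain i \<alpha> \<beta> where b_eq: "b = (i, \<alpha>, \<beta>)" by (cases b)
  have i: "i \<in> {1..m}" "\<alpha> \<in> expos (\<Delta> i) d" "\<beta> \<in> expos (\<Delta> i) d"
    using b by (auto simp: b_eq gram_index_def)
  have psd: "psd_on (expos (\<Delta> i) d) (\<lambda>\<alpha> \<beta>. W (i, \<alpha>, \<beta>))" if "i \<in> {1..m}" for i
    using W that by (simp add: gram_cone_def)
  have pair: "1/2 * ?tr i \<le> (\<Sum>\<alpha>\<in>expos (\<Delta> i) d. \<Sum>\<beta>\<in>expos (\<Delta> i) d. W (i, \<alpha>, \<beta>) * ?M \<alpha> \<beta>)"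
    if "i \<in> {1..m}" for i
  proof (rule psd_on_pairing_ge_trace[OF finite_expos psd[OF that] strictly_positive_moments[OF finite_expos _ t(2)]])
    \<comment> \<open>Counting exponents over all variables gives one \<open>t\<close> that serves
      every clique.\<close>
    have "card (expos (\<Delta> i) d) \<le> card (expos (UNIV :: 'n set) d)"
      by (intro card_mono finite_expos) (auto simp: expos_def)
    then show "2 * real (card (expos (\<Delta> i) d)) \<le> t" using t by linarith
  qed
  have "\<bar>W b\<bar> \<le> ?tr i"
    using psd_on_abs_le_trace[OF finite_expos psd] i by (simp add: b_eq)
  also have "\<dots> \<le> (\<Sum>i=1..m. ?tr i)"
    using i psd_on_diag_nonneg[OF finite_expos psd]
    by (intro member_le_sum[where f = ?tr] sum_nonneg) auto
  also have "\<dots> \<le> (\<Sum>i=1..m. 2 * (\<Sum>\<alpha>\<in>expos (\<Delta> i) d. \<Sum>\<beta>\<in>expos (\<Delta> i) d. W (i, \<alpha>, \<beta>) * ?M \<alpha> \<beta>))"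
    by (rule sum_mono) (use pair in force)
  also have "\<dots> = 2 * (\<Sum>\<gamma>\<in>sparse_expos m \<Delta> d. t ^ expo_sqnorm \<gamma> *
      (\<Sum>b\<in>gram_index m \<Delta> d. of_bool (fst (snd b) + snd (snd b) = \<gamma>) * W b))"
    unfolding sum_moments_gram_index[OF W] by (simp only: sum_distrib_left)
  finally show ?thesis by (simp add: sum_distrib_left mult_ac)
qed

text \<open>Representability becomes a linear system for one vector of Gram entries, to which the
  cone separation applies; rank-one test families then translate nonnegativity on the cone into
  conditions on the moment matrices.\<close>

lemma sparse_separation:
  fixes \<Delta> :: "nat \<Rightarrow> 'n::finite set"
  assumes keys: "Poly_Mapping.keys p \<subseteq> sparse_expos m \<Delta> d"
    and notin: "\<And>W. (\<And>i. i \<in> {1..m} \<Longrightarrow> psd_on (expos (\<Delta> i) d) (W i)) \<Longrightarrow>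
      p \<noteq> (\<Sum>i=1..m. gram_poly (\<Delta> i) d (W i))"
  obtains r where "\<And>i. i \<in> {1..m} \<Longrightarrow> psd_on (expos (\<Delta> i) d) (moment_matrix r)" "riesz r p < 0"
proof -
  define t where "t = max 1 (2 * real (card (expos (UNIV :: 'n set) d)))"
  have t: "2 * real (card (expos (UNIV :: 'n set) d)) \<le> t" "1 \<le> t" by (auto simp: t_def)
  define c where "c = (\<lambda>\<gamma> (b :: nat \<times> 'n expo \<times> 'n expo). of_bool (fst (snd b) + snd (snd b) = \<gamma>) :: real)"
  have inhom: "\<exists>\<gamma>\<in>sparse_expos m \<Delta> d. (\<Sum>b\<in>gram_index m \<Delta> d. c \<gamma> b * W b) \<noteq> coeff p \<gamma>"
    if "W \<in> gram_cone m \<Delta> d" for W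
  proof (rule ccontr)
    let ?q = "\<Sum>i=1..m. gram_poly (\<Delta> i) d (\<lambda>\<alpha> \<beta>. W (i, \<alpha>, \<beta>))"
    assume *: "\<not> (\<exists>\<gamma>\<in>sparse_expos m \<Delta> d. (\<Sum>b\<in>gram_index m \<Delta> d. c \<gamma> b * W b) \<noteq> coeff p \<gamma>)"
    have q: "coeff ?q \<gamma> = (\<Sum>b\<in>gram_index m \<Delta> d. c \<gamma> b * W b)" for \<gamma>
      by (simp add: lookup_sum coeff_gram_poly sum_gram_index c_def)
    have "coeff p \<gamma> = coeff ?q \<gamma>" for \<gamma>
    \<comment> \<open>The linear system has equations only on \<open>sparse_expos\<close>; elsewhere
      both coefficients are 0.\<close>
    proof (cases "\<gamma> \<in> sparse_expos m \<Delta> d")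
      case False
      then have "coeff p \<gamma> = 0" using keys by (auto simp: in_keys_iff)
      moreover have "c \<gamma> b = 0" if "b \<in> gram_index m \<Delta> d" for b
        using that False expos_add_in_sparse_expos[of _ m _ \<Delta> d] by (auto simp: c_def gram_index_def)
      ultimately show ?thesis unfolding q by simp
    qed (use * q in auto)
    then have "p = ?q" by (rule poly_mapping_eqI)
    then show False using notin[of "\<lambda>i \<alpha> \<beta>. W (i, \<alpha>, \<beta>)"] that by (auto simp: gram_cone_def)
  qed
  obtain r where r: "\<And>W. W \<in> gram_cone m \<Delta> d \<Longrightarrow>
      0 \<le> (\<Sum>\<gamma>\<in>sparse_expos m \<Delta> d. r \<gamma> * (\<Sum>b\<in>gram_index m \<Delta> d. c \<gamma> b * W b))"
    and neg: "(\<Sum>\<gamma>\<in>sparse_expos m \<Delta> d. r \<gamma> * coeff p \<gamma>) < 0"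
  proof (rule coercive_cone_separation[of "gram_index m \<Delta> d" "sparse_expos m \<Delta> d" "gram_cone m \<Delta> d"
        "\<lambda>\<gamma>. 2 * t ^ expo_sqnorm \<gamma>" c "coeff p"])
    show "\<bar>W b\<bar> \<le> (\<Sum>a\<in>sparse_expos m \<Delta> d. 2 * t ^ expo_sqnorm a * (\<Sum>b\<in>gram_index m \<Delta> d. c a b * W b))"
      if "W \<in> gram_cone m \<Delta> d" "b \<in> gram_index m \<Delta> d" for W b
      unfolding c_def using gram_cone_coercive[OF t that] .
  qed (auto simp: finite_gram_index finite_sparse_expos closed_gram_cone inhom,
       auto simp: gram_cone_def intro: psd_on_zero psd_on_add psd_on_scale)
  show thesis
  proof
    show "riesz r p < 0"
      using neg by (simp add: riesz_eq_sum[OF finite_sparse_expos keys] mult.commute)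
    fix j assume j: "j \<in> {1..m}"
    show "psd_on (expos (\<Delta> j) d) (moment_matrix r)"
      unfolding psd_on_def
    proof (intro conjI ballI allI)
      fix v :: "'n expo \<Rightarrow> real"
      let ?V = "\<lambda>(i, \<alpha>, \<beta>). if i = j \<and> (i, \<alpha>, \<beta>) \<in> gram_index m \<Delta> d then v \<alpha> * v \<beta> else 0"
      have "0 \<le> (\<Sum>i=1..m. \<Sum>\<alpha>\<in>expos (\<Delta> i) d. \<Sum>\<beta>\<in>expos (\<Delta> i) d. ?V (i, \<alpha>, \<beta>) * moment_matrix r \<alpha> \<beta>)"
        using r[OF rank_one_in_gram_cone, of j v]
        unfolding c_def sum_moments_gram_index[OF rank_one_in_gram_cone] .
      also have "\<dots> = (\<Sum>i=1..m. if i = j then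
          \<Sum>\<alpha>\<in>expos (\<Delta> i) d. \<Sum>\<beta>\<in>expos (\<Delta> i) d. v \<alpha> * moment_matrix r \<alpha> \<beta> * v \<beta> else 0)"
        by (intro sum.cong refl) (auto simp: gram_index_def intro!: sum.cong)
      also have "\<dots> = (\<Sum>\<alpha>\<in>expos (\<Delta> j) d. \<Sum>\<beta>\<in>expos (\<Delta> j) d. v \<alpha> * moment_matrix r \<alpha> \<beta> * v \<beta>)"
        using j by simp
      finally show "0 \<le> (\<Sum>\<alpha>\<in>expos (\<Delta> j) d. \<Sum>\<beta>\<in>expos (\<Delta> j) d. v \<alpha> * moment_matrix r \<alpha> \<beta> * v \<beta>)" .
    qed (simp add: moment_matrix_def add.commute)
  qed
qed

text \<open>The separating functional may vanish at \<open>1\<close>; a small multiple of evaluation at the origin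
  is added before normalising.\<close>

lemma f_Sigma_le_of_not_gram:
  fixes \<Delta> :: "nat \<Rightarrow> 'n::finite set"
  assumes m: "1 \<le> m" and keys: "Poly_Mapping.keys f \<subseteq> sparse_expos m \<Delta> d"
    and notin: "\<And>W. (\<And>i. i \<in> {1..m} \<Longrightarrow> psd_on (expos (\<Delta> i) d) (W i)) \<Longrightarrow>
      f - const_poly \<gamma> \<noteq> (\<Sum>i=1..m. gram_poly (\<Delta> i) d (W i))"
  shows "f_Sigma m \<Delta> d f \<le> ereal \<gamma>"
proof -
  let ?F = "sparse_expos m \<Delta> d"
  have zero: "0 \<in> ?F"
    using m zero_in_expos by (auto simp: sparse_expos_def intro!: bexI[of _ 1])
  have "Poly_Mapping.keys (f - const_poly \<gamma>) \<subseteq> ?F"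
    using keys zero keys_diff[of f "const_poly \<gamma>"] by (auto simp: const_poly_def split: if_splits)
  from sparse_separation[OF this notin]
  obtain r where r: "\<And>i. i \<in> {1..m} \<Longrightarrow> psd_on (expos (\<Delta> i) d) (moment_matrix r)"
      and neg: "riesz r (f - const_poly \<gamma>) < 0"
    by blast
  \<comment> \<open>Small enough that the contribution \<open>e * (coeff f 0 - \<gamma>)\<close> of
    the origin does not exceed the gap \<open>- riesz r (f - const_poly \<gamma>)\<close>; the 1 in
    the denominator prevents division by 0.\<close>
  define e where "e = - riesz r (f - const_poly \<gamma>) / (1 + \<bar>coeff f 0 - \<gamma>\<bar>)"
  have "0 < e" unfolding e_def using neg by (intro divide_pos_pos) auto
  \<comment> \<open>\<open>r 0\<close> is a diagonal moment entry of the first clique, so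
    \<open>r 0 + e\<close> is positive and can be divided out.\<close>
  have "0 \<le> r 0"
    using psd_on_diag_nonneg[OF finite_expos r zero_in_expos, of 1] m by (simp add: moment_matrix_def)
  define y' where "y' \<alpha> = 1 / (r 0 + e) * (r \<alpha> + e * of_bool (\<alpha> = 0))" for \<alpha>
  \<comment> \<open>Feasible vectors are extensional on \<open>sparse_expos\<close>, hence the
    restriction.\<close>
  define y where "y = restrict y' ?F"
  have psd: "psd_on (expos (\<Delta> i) d) (moment_matrix y)" if "i \<in> {1..m}" for i
  proof -
    have "psd_on (expos (\<Delta> i) d) (\<lambda>\<alpha> \<beta>. 1 / (r 0 + e) *
        (moment_matrix r \<alpha> \<beta> + e * moment_matrix (\<lambda>\<alpha>. of_bool (\<alpha> = 0)) \<alpha> \<beta>))"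
      using \<open>0 < e\<close> \<open>0 \<le> r 0\<close> r[OF that]
      by (intro psd_on_scale psd_on_add psd_on_moments_at_origin) auto
    moreover have "moment_matrix y \<alpha> \<beta> = 1 / (r 0 + e) *
        (moment_matrix r \<alpha> \<beta> + e * moment_matrix (\<lambda>\<alpha>. of_bool (\<alpha> = 0)) \<alpha> \<beta>)"
      if "\<alpha> \<in> expos (\<Delta> i) d" "\<beta> \<in> expos (\<Delta> i) d" for \<alpha> \<beta>
      using expos_add_in_sparse_expos[of i m \<alpha> \<Delta> d \<beta>] \<open>i \<in> {1..m}\<close> that
      by (simp add: moment_matrix_def y_def y'_def)
    ultimately show ?thesis by (subst psd_on_cong)
  qed
  have "y 0 = 1"
    using zero \<open>0 < e\<close> \<open>0 \<le> r 0\<close> by (simp add: y_def y'_def)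
  have "(\<Sum>\<alpha>\<in>?F. coeff f \<alpha> * y \<alpha>) = 1 / (r 0 + e) *
      ((\<Sum>\<alpha>\<in>?F. coeff f \<alpha> * r \<alpha>) + e * (\<Sum>\<alpha>\<in>?F. if \<alpha> = 0 then coeff f 0 else 0))"
    unfolding sum_distrib_left sum.distrib[symmetric]
    by (intro sum.cong refl) (auto simp: y_def y'_def algebra_simps)
  also have "\<dots> = (riesz r f + e * coeff f 0) / (r 0 + e)"
    using zero by (simp add: riesz_eq_sum[OF finite_sparse_expos keys] finite_sparse_expos)
  also have "\<dots> \<le> \<gamma>"
  proof -
    have "e * (coeff f 0 - \<gamma>) \<le> e * (1 + \<bar>coeff f 0 - \<gamma>\<bar>)"
      using \<open>0 < e\<close> by (intro mult_left_mono) auto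
    also have "\<dots> = - riesz r (f - const_poly \<gamma>)"
      by (simp add: e_def)
    finally show ?thesis
      using \<open>0 < e\<close> \<open>0 \<le> r 0\<close> by (simp add: riesz_diff divide_le_eq algebra_simps)
  qed
  finally have val: "(\<Sum>\<alpha>\<in>?F. coeff f \<alpha> * y \<alpha>) \<le> \<gamma>" .
  have "y \<in> ?F \<rightarrow>\<^sub>E UNIV"
    by (simp add: y_def)
  then show ?thesis
    unfolding f_Sigma_def using psd \<open>y 0 = 1\<close> val by (intro INF_lower2[of y]) auto
qed

text \<open>Strong duality: a real \<gamma> strictly below the moment value must have a Gram
  representation, since otherwise \<gamma> would bound that value from above. Approximation from
  below treats finite and infinite values alike.\<close>

lemma f_Sigma_le_f_Delta:
  assumes "1 \<le> m" "Poly_Mapping.keys f \<subseteq> sparse_expos m \<Delta> d"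
  shows "f_Sigma m \<Delta> d f \<le> f_Delta m \<Delta> d f"
proof (rule dense_le)
  fix z assume "z < f_Sigma m \<Delta> d f"
  then obtain \<gamma> where \<gamma>: "z < ereal \<gamma>" "ereal \<gamma> < f_Sigma m \<Delta> d f"
    using ereal_dense2 by blast
  have "\<exists>W. (\<forall>i\<in>{1..m}. psd_on (expos (\<Delta> i) d) (W i)) \<and>
      f - const_poly \<gamma> = (\<Sum>i=1..m. gram_poly (\<Delta> i) d (W i))"
  proof (rule ccontr)
    assume "\<not> ?thesis"
    then have "f_Sigma m \<Delta> d f \<le> ereal \<gamma>"
      by (intro f_Sigma_le_of_not_gram[OF assms]) blast
    then show False using \<gamma>(2) by simp
  qed
  then have "ereal \<gamma> \<le> f_Delta m \<Delta> d f"
    unfolding f_Delta_def by (intro SUP_upper CollectI)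
  with \<gamma> show "z \<le> f_Delta m \<Delta> d f" by simp
qed

theorem theorem3p1:
  fixes f :: "'n::finite rpoly"
    and fi :: "nat \<Rightarrow> 'n rpoly"
    and \<Delta> :: "nat \<Rightarrow> 'n set"
    and m d :: nat
    and di :: "nat \<Rightarrow> nat"
  assumes "1 \<le> m"
    and "f = (\<Sum>i=1..m. fi i)"
    and "\<And>i. i \<in> {1..m} \<Longrightarrow> fi i \<in> polys_in (\<Delta> i)"
    and "\<And>i. i \<in> {1..m} \<Longrightarrow> total_degree (fi i) = 2 * di i"
    and "total_degree f = 2 * d"
    and "2 * d = Max ((\<lambda>i. 2 * di i) ` {1..m})"
  shows "f_Sigma m \<Delta> d f = f_Delta m \<Delta> d f \<and>
         f_Delta m \<Delta> d f \<le> f_sos f \<and>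
         f_sos f \<le> f_star f"
proof -
  \<comment> \<open>The bound comes from the maximum over the summands; the degree of
    \<open>f\<close> alone would not exclude higher terms that cancel.\<close>
  have "total_degree (fi i) \<le> 2 * d" if "i \<in> {1..m}" for i
    using assms(4)[OF that] assms(6) that by (simp add: Max_ge)
  then have "Poly_Mapping.keys f \<subseteq> sparse_expos m \<Delta> d"
    using assms(2,3) by (intro keys_subset_sparse_expos)
  then show ?thesis
    using f_Sigma_le_f_Delta f_Delta_le_f_Sigma f_Delta_le_f_sos f_sos_le_f_star assms(1)
    by (metis order.antisym)
qed

end
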